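(* Let $n$ be a positive integer. For all positive integers $h$ and $k$, \[ \mathcal{R}_{\mathbf{Z}}(h,k) = \mathcal{R}_{\mathbf{Z}^n}(h,k) \] and \[ \widehat{\mathcal{R}}_{\mathbf{Z}}(h,k) = \widehat{\mathcal{R}}_{\mathbf{Z}^n}(h,k). \]
   Context: $\mathbf{Z}$ is the additive group of integers and $\mathbf{Z}^n$ is the additive group of $n$-dimensional lattice points (with coordinatewise addition). Let $X$ be an additive abelian semigroup, let $A$ be a nonempty finite subset of $X$, and let $h$ and $k$ be positive integers. The $h$-fold sumset $hA$ is the set of all sums $a_1+\cdots+a_h$ of $h$ not necessarily distinct elements $a_1,\ldots,a_h$ of $A$. The restricted $h$-fold sumset $\widehat{hA}$ is the set of all sums $a_1+\cdots+a_h$ of $h$ pairwise distinct elements $a_1,\ldots,a_h$ of $A$ (so it is empty if $|A|<h$). The range of sumset sizes is the set of cardinalities \[ \mathcal{R}_X(h,k) = \left\{ |hA| : A \subseteq X \text{ and } |A| = k \right\}, \] and the range of restricted sumset sizes is \[ \widehat{\mathcal{R}}_X(h,k) = \left\{ \left|\widehat{hA}\right| : A \subseteq X \text{ and } |A| = k \right\}. \] *)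

theory Defs
  imports "HOL-Analysis.Finite_Cartesian_Product" "HOL-Library.FuncSet"
begin

definition sumset :: "nat \<Rightarrow> 'a::comm_monoid_add set \<Rightarrow> 'a set" where
  "sumset h A = {\<Sum>i<h. a i | a. a \<in> {..<h} \<rightarrow> A}"

definition restricted_sumset :: "nat \<Rightarrow> 'a::comm_monoid_add set \<Rightarrow> 'a set" where
  "restricted_sumset h A = {\<Sum>i<h. a i | a. a \<in> {..<h} \<rightarrow> A \<and> inj_on a {..<h}}"

text \<open>
  In the following two definitions, finiteness of \<open>A\<close> is stated separately because
  \<open>card\<close> is \<open>0\<close> on infinite sets.
\<close>

definition sumset_sizes :: "'a::comm_monoid_add set \<Rightarrow> nat \<Rightarrow> nat \<Rightarrow> nat set" where
  "sumset_sizes X h k = {card (sumset h A) | A. A \<subseteq> X \<and> finite A \<and> card A = k}"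

definition restricted_sumset_sizes :: "'a::comm_monoid_add set \<Rightarrow> nat \<Rightarrow> nat \<Rightarrow> nat set" where
  "restricted_sumset_sizes X h k =
    {card (restricted_sumset h A) | A. A \<subseteq> X \<and> finite A \<and> card A = k}"

end

theory Submission
  imports Defs "HOL-Computational_Algebra.Polynomial"
begin

text \<open>
  An additive map \<open>f\<close> carries \<open>hA\<close> onto \<open>h f(A)\<close>. If \<open>f\<close> is injective on the finite set
  \<open>A \<union> hA\<close>, then neither \<open>|A|\<close> nor the size of the sumset changes, and the same holds for the
  restricted sumset, because \<open>f\<close> then preserves distinctness of the summands. Hence every size
  attained in one monoid is attained in another as soon as each finite subset of the first can be
  mapped injectively into the second by an additive map
  (\<open>sumset_sizes_subset\<close>, \<open>restricted_sumset_sizes_subset\<close>).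

  From \<open>\<int>\<close> to \<open>\<int>\<^sup>n\<close> the diagonal embedding serves all finite sets at once. From \<open>\<int>\<^sup>n\<close>
  to \<open>\<int>\<close> no additive map is injective when \<open>n > 1\<close>, but for each finite set there is one
  injective on it (\<open>exists_additive_inj_on_finite\<close>): view the vectors as integer polynomials and
  evaluate them at an integer that is a root of none of the finitely many nonzero differences.
\<close>

lemma restricted_sumset_subset_sumset: "restricted_sumset h A \<subseteq> sumset h A"
  unfolding restricted_sumset_def sumset_def by blast

lemma finite_sumset:
  assumes "finite A"
  shows "finite (sumset h A)"
proof -
  \<comment> \<open>The functions in \<open>{..<h} \<rightarrow> A\<close> are arbitrary outside \<open>{..<h}\<close>, so there are in general
    infinitely many of them; restricting them to \<open>{..<h}\<close> leaves finitely many.\<close>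
  have "sumset h A \<subseteq> (\<lambda>a. \<Sum>i<h. a i) ` ({..<h} \<rightarrow>\<^sub>E A)"
  proof
    fix s assume "s \<in> sumset h A"
    then obtain a where a: "a \<in> {..<h} \<rightarrow> A" and s: "s = (\<Sum>i<h. a i)"
      unfolding sumset_def by blast
    have "s = (\<Sum>i<h. restrict a {..<h} i)"
      unfolding s by (rule sum.cong) auto
    moreover have "restrict a {..<h} \<in> {..<h} \<rightarrow>\<^sub>E A"
      using a by auto
    ultimately show "s \<in> (\<lambda>a. \<Sum>i<h. a i) ` ({..<h} \<rightarrow>\<^sub>E A)"
      by blast
  qed
  moreover have "finite ({..<h} \<rightarrow>\<^sub>E A)"
    using assms by (simp add: finite_PiE)
  ultimately show ?thesis
    by (meson finite_imageI finite_subset)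
qed

context
  fixes f :: "'a::comm_monoid_add \<Rightarrow> 'b::comm_monoid_add"
  assumes zero: "f 0 = 0" and add: "\<And>x y. f (x + y) = f x + f y"
begin

lemma additive_sum: "f (\<Sum>i\<in>I. a i) = (\<Sum>i\<in>I. f (a i))"
  using sum_comp_morphism[of f a I] zero add by (simp add: comp_def)

lemma sumset_image: "sumset h (f ` A) = f ` sumset h A"
proof
  show "sumset h (f ` A) \<subseteq> f ` sumset h A"
  proof
    fix s assume "s \<in> sumset h (f ` A)"
    then obtain b where b: "b \<in> {..<h} \<rightarrow> f ` A" and s: "s = (\<Sum>i<h. b i)"
      unfolding sumset_def by blast
    have fa: "f (inv_into A f (b i)) = b i" and a: "inv_into A f (b i) \<in> A" if "i < h" for i
      using funcset_mem[OF b, of i] that by (simp_all add: f_inv_into_f inv_into_into)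
    have "s = f (\<Sum>i<h. inv_into A f (b i))"
      unfolding s additive_sum by (rule sum.cong) (simp_all add: fa)
    moreover have "(\<Sum>i<h. inv_into A f (b i)) \<in> sumset h A"
      using a unfolding sumset_def by auto
    ultimately show "s \<in> f ` sumset h A"
      by blast
  qed
  show "f ` sumset h A \<subseteq> sumset h (f ` A)"
  proof
    fix s assume "s \<in> f ` sumset h A"
    then obtain a where "a \<in> {..<h} \<rightarrow> A" and "s = f (\<Sum>i<h. a i)"
      unfolding sumset_def by blast
    then have "s = (\<Sum>i<h. (f \<circ> a) i)" and "f \<circ> a \<in> {..<h} \<rightarrow> f ` A"
      by (auto simp: additive_sum)
    then show "s \<in> sumset h (f ` A)"
      unfolding sumset_def by blast
  qed
qed

text \<open>
  Without injectivity on \<open>A\<close> the inclusion from right to left can fail: distinct summands may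
  acquire equal images.
\<close>

lemma restricted_sumset_image:
  assumes inj: "inj_on f A"
  shows "restricted_sumset h (f ` A) = f ` restricted_sumset h A"
proof
  show "restricted_sumset h (f ` A) \<subseteq> f ` restricted_sumset h A"
  proof
    fix s assume "s \<in> restricted_sumset h (f ` A)"
    then obtain b where b: "b \<in> {..<h} \<rightarrow> f ` A" and injb: "inj_on b {..<h}"
      and s: "s = (\<Sum>i<h. b i)"
      unfolding restricted_sumset_def by blast
    let ?a = "inv_into A f \<circ> b"
    have fa: "f (?a i) = b i" and a: "?a i \<in> A" if "i < h" for i
      using funcset_mem[OF b, of i] that by (simp_all add: f_inv_into_f inv_into_into)
    have "inj_on ?a {..<h}"
      using injb fa by (metis inj_on_def lessThan_iff)
    moreover have "?a \<in> {..<h} \<rightarrow> A"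
      using a by auto
    ultimately have "(\<Sum>i<h. ?a i) \<in> restricted_sumset h A"
      unfolding restricted_sumset_def by blast
    moreover have "s = f (\<Sum>i<h. ?a i)"
      unfolding s additive_sum by (rule sum.cong) (simp_all add: fa[unfolded comp_def])
    ultimately show "s \<in> f ` restricted_sumset h A"
      by blast
  qed
  show "f ` restricted_sumset h A \<subseteq> restricted_sumset h (f ` A)"
  proof
    fix s assume "s \<in> f ` restricted_sumset h A"
    then obtain a where a: "a \<in> {..<h} \<rightarrow> A" and inja: "inj_on a {..<h}"
      and s: "s = f (\<Sum>i<h. a i)"
      unfolding restricted_sumset_def by blast
    have "inj_on f (a ` {..<h})"
      using inj a by (auto intro: inj_on_subset)
    then have "inj_on (f \<circ> a) {..<h}"
      using inja by (rule comp_inj_on[rotated])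
    moreover have "s = (\<Sum>i<h. (f \<circ> a) i)" and "f \<circ> a \<in> {..<h} \<rightarrow> f ` A"
      using a s by (auto simp: additive_sum)
    ultimately show "s \<in> restricted_sumset h (f ` A)"
      unfolding restricted_sumset_def by blast
  qed
qed

end

text \<open>
  The map may depend on the finite set. This is what makes the comparison possible from
  \<open>\<int>\<^sup>n\<close> to \<open>\<int>\<close>, where a single injective additive map need not exist.
\<close>

lemma sumset_sizes_subset:
  assumes embed: "\<And>S :: 'a::comm_monoid_add set. finite S \<Longrightarrow>
    \<exists>f :: 'a \<Rightarrow> 'b::comm_monoid_add. f 0 = 0 \<and> (\<forall>x y. f (x + y) = f x + f y) \<and> inj_on f S"
  shows "sumset_sizes (UNIV :: 'a set) h k \<subseteq> sumset_sizes (UNIV :: 'b set) h k"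
proof
  fix m assume "m \<in> sumset_sizes (UNIV :: 'a set) h k"
  then obtain A :: "'a set" where A: "finite A" "card A = k" and m: "m = card (sumset h A)"
    unfolding sumset_sizes_def by blast
  obtain f :: "'a \<Rightarrow> 'b" where f: "f 0 = 0" "\<And>x y. f (x + y) = f x + f y"
    and inj: "inj_on f (A \<union> sumset h A)"
    using embed[of "A \<union> sumset h A"] A finite_sumset by blast
  have "card (f ` A) = k"
    using A inj by (simp add: card_image inj_on_Un)
  moreover have "card (sumset h (f ` A)) = m"
    using inj m by (simp add: sumset_image[OF f] card_image inj_on_Un)
  ultimately show "m \<in> sumset_sizes (UNIV :: 'b set) h k"
    using A unfolding sumset_sizes_def by blast
qed

lemma restricted_sumset_sizes_subset:
  assumes embed: "\<And>S :: 'a::comm_monoid_add set. finite S \<Longrightarrow>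
    \<exists>f :: 'a \<Rightarrow> 'b::comm_monoid_add. f 0 = 0 \<and> (\<forall>x y. f (x + y) = f x + f y) \<and> inj_on f S"
  shows "restricted_sumset_sizes (UNIV :: 'a set) h k
    \<subseteq> restricted_sumset_sizes (UNIV :: 'b set) h k"
proof
  fix m assume "m \<in> restricted_sumset_sizes (UNIV :: 'a set) h k"
  then obtain A :: "'a set" where A: "finite A" "card A = k"
    and m: "m = card (restricted_sumset h A)"
    unfolding restricted_sumset_sizes_def by blast
  have "finite (A \<union> restricted_sumset h A)"
    using A finite_sumset finite_subset[OF restricted_sumset_subset_sumset] by blast
  then obtain f :: "'a \<Rightarrow> 'b" where f: "f 0 = 0" "\<And>x y. f (x + y) = f x + f y"
    and inj: "inj_on f (A \<union> restricted_sumset h A)"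
    using embed by blast
  have injA: "inj_on f A" and injR: "inj_on f (restricted_sumset h A)"
    using inj by (simp_all add: inj_on_Un)
  have "card (f ` A) = k"
    using A injA by (simp add: card_image)
  moreover have "card (restricted_sumset h (f ` A)) = m"
    using injR m by (simp add: restricted_sumset_image[OF f injA] card_image)
  ultimately show "m \<in> restricted_sumset_sizes (UNIV :: 'b set) h k"
    using A unfolding restricted_sumset_sizes_def by blast
qed

text \<open>
  Using the coordinates as coefficients turns \<open>\<int>\<^sup>n\<close> into a group of polynomials, on which
  evaluation at an integer \<open>t\<close> is additive. It identifies two polynomials only if \<open>t\<close> is a root
  of their difference, and finitely many nonzero polynomials have finitely many roots in total.
\<close>

lemma exists_additive_inj_on_finite:
  fixes S :: "(int ^ 'n::finite) set"
  assumes "finite S"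
  shows "\<exists>f :: int ^ 'n \<Rightarrow> int. f 0 = 0 \<and> (\<forall>x y. f (x + y) = f x + f y) \<and> inj_on f S"
proof -
  obtain e :: "'n \<Rightarrow> nat" where e: "inj e"
    using finite_imp_inj_to_nat_seg[of "UNIV :: 'n set"] by auto
  define p :: "int ^ 'n \<Rightarrow> int poly" where "p x = (\<Sum>j\<in>UNIV. monom (x $ j) (e j))" for x
  have p_zero: "p 0 = 0"
    unfolding p_def by simp
  have p_add: "p (x + y) = p x + p y" for x y
    unfolding p_def by (simp add: add_monom[symmetric] sum.distrib)
  have coeff_p: "coeff (p x) (e i) = x $ i" for x i
  proof -
    have "coeff (p x) (e i) = (\<Sum>j\<in>UNIV. if i = j then x $ j else 0)"
      unfolding p_def coeff_sum using e by (intro sum.cong) (auto dest: injD)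
    then show ?thesis
      by simp
  qed
  have inj_p: "x = y" if "p x = p y" for x y
    using that coeff_p by (metis vec_eq_iff)
  let ?D = "{(x, y) \<in> S \<times> S. x \<noteq> y}"
  let ?R = "\<Union>(x, y)\<in>?D. {t. poly (p x - p y) t = 0}"
  have "finite ?D"
    by (rule finite_subset[of _ "S \<times> S"]) (use assms in auto)
  moreover have "finite {t. poly (p x - p y) t = 0}" if "x \<noteq> y" for x y
    using that inj_p by (intro poly_roots_finite) auto
  ultimately have "finite ?R"
    by auto
  then obtain t where t: "t \<notin> ?R"
    using infinite_UNIV_int ex_new_if_finite by blast
  have "inj_on (\<lambda>x. poly (p x) t) S"
    using t by (auto intro!: inj_onI)
  then show ?thesis
    by (intro exI[of _ "\<lambda>x. poly (p x) t"]) (simp add: p_zero p_add)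
qed

theorem theorem1:
  fixes h k :: nat
  assumes "h > 0" and "k > 0"
  shows "sumset_sizes (UNIV :: int set) h k = sumset_sizes (UNIV :: (int ^ 'n::finite) set) h k
    \<and> restricted_sumset_sizes (UNIV :: int set) h k
      = restricted_sumset_sizes (UNIV :: (int ^ 'n::finite) set) h k"
proof -
  have diagonal: "\<exists>f :: int \<Rightarrow> int ^ 'n. f 0 = 0 \<and> (\<forall>x y. f (x + y) = f x + f y) \<and> inj_on f S" for S
    by (intro exI[of _ "\<lambda>x. \<chi> i. x"]) (auto simp: vec_eq_iff intro: inj_onI)
  show ?thesis
    by (intro conjI equalityI sumset_sizes_subset restricted_sumset_sizes_subset
        diagonal exists_additive_inj_on_finite)
qed

end
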